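(* Let $F$ be a baseline distribution function and, for $\beta,\theta>0$, let $G_{\beta,\theta}$ be the distribution function whose odds function is $\Lambda_{G_{\beta,\theta}}(x)=\beta\,\Lambda_F(x)^\theta$. Then: 1. If $F$ has increasing hazard rate and $\beta\le 1$, then $G_{\beta,1}$ has increasing hazard rate. 2. If $F$ has decreasing hazard rate and $\beta\ge 1$, then $G_{\beta,1}$ has decreasing hazard rate. 3. If $F$ has increasing odds rate and $\theta\ge 1$, then $G_{\beta,\theta}$ has increasing odds rate (for every $\beta>0$).
   Context: The baseline $F$ is a distribution function on $\mathbb{R}$ with density $f$; $\overline F=1-F$. For a distribution function $H$ with density $h$: the hazard rate is $h_H=h/\overline H$, the odds function is $\Lambda_H=H/\overline H=1/\overline H-1$ (equal to $+\infty$ where $\overline H=0$), and the odds rate is $\lambda_H=\Lambda_H'=h/\overline H^2$. Explicitly, $G_{\beta,\theta}=\dfrac{\beta F^\theta}{\beta F^\theta+\overline F^\theta}$, with density $g_{\beta,\theta}=\beta\theta f\,\dfrac{F^{\theta-1}\overline F^{\theta-1}}{(\beta F^\theta+\overline F^\theta)^2}$. "Increasing" and "decreasing" are in the weak sense; monotonicity of rates is understood on the set where $0<F<1$ (the support). *)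

theory Defs
  imports "HOL-Probability.Probability"
begin

definition distribution_function :: "(real \<Rightarrow> real) \<Rightarrow> bool" where
  "distribution_function H \<longleftrightarrow> (\<exists>M. real_distribution M \<and> H = cdf M)"

definition has_density :: "(real \<Rightarrow> real) \<Rightarrow> (real \<Rightarrow> real) \<Rightarrow> bool" where
  "has_density H h \<longleftrightarrow>
     h \<in> borel_measurable borel \<and> (\<forall>x. 0 \<le> h x) \<and>
     real_distribution (density lborel (\<lambda>x. ennreal (h x))) \<and>
     H = cdf (density lborel (\<lambda>x. ennreal (h x)))"

definition odds :: "(real \<Rightarrow> real) \<Rightarrow> real \<Rightarrow> ennreal" where
  "odds H x = (if 1 - H x = 0 then \<top> else ennreal (H x / (1 - H x)))"

definition ennreal_powr :: "ennreal \<Rightarrow> real \<Rightarrow> ennreal" where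
  "ennreal_powr z \<theta> = (if z = \<top> then \<top> else ennreal (enn2real z powr \<theta>))"
  \<comment> \<open>The real power of an extended nonnegative number, for positive exponents only.\<close>

definition hazard_rate :: "(real \<Rightarrow> real) \<Rightarrow> (real \<Rightarrow> real) \<Rightarrow> real \<Rightarrow> real" where
  "hazard_rate H h x = h x / (1 - H x)"

definition odds_rate :: "(real \<Rightarrow> real) \<Rightarrow> (real \<Rightarrow> real) \<Rightarrow> real \<Rightarrow> real" where
  "odds_rate H h x = h x / (1 - H x)\<^sup>2"

text \<open>
  A density is unique only up to null sets, whereas monotonicity of a rate is a pointwise
  condition, so the following properties refer to a distribution function \<open>H\<close> together with a
  chosen version \<open>h\<close> of its density. That \<open>h\<close> really is a density of \<open>H\<close> is part of each property.
\<close>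

definition increasing_hazard_rate :: "(real \<Rightarrow> real) \<Rightarrow> (real \<Rightarrow> real) \<Rightarrow> bool" where
  "increasing_hazard_rate H h \<longleftrightarrow>
     has_density H h \<and> mono_on {x. 0 < H x \<and> H x < 1} (hazard_rate H h)"

definition decreasing_hazard_rate :: "(real \<Rightarrow> real) \<Rightarrow> (real \<Rightarrow> real) \<Rightarrow> bool" where
  "decreasing_hazard_rate H h \<longleftrightarrow>
     has_density H h \<and> antimono_on {x. 0 < H x \<and> H x < 1} (hazard_rate H h)"

definition increasing_odds_rate :: "(real \<Rightarrow> real) \<Rightarrow> (real \<Rightarrow> real) \<Rightarrow> bool" where
  "increasing_odds_rate H h \<longleftrightarrow>
     has_density H h \<and> mono_on {x. 0 < H x \<and> H x < 1} (odds_rate H h)"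

definition odds_family_of :: "(real \<Rightarrow> real) \<Rightarrow> (real \<Rightarrow> real \<Rightarrow> real \<Rightarrow> real) \<Rightarrow> bool" where
  "odds_family_of F G \<longleftrightarrow>
     (\<forall>\<beta> \<theta>. 0 < \<beta> \<longrightarrow> 0 < \<theta> \<longrightarrow>
        distribution_function (G \<beta> \<theta>) \<and>
        (\<forall>x. odds (G \<beta> \<theta>) x = ennreal \<beta> * ennreal_powr (odds F x) \<theta>))"

text \<open>
  The density of \<open>G \<beta> \<theta>\<close>. Since \<open>0 powr a = 0\<close> for every \<open>a\<close>, including \<open>a = 0\<close>, this formula
  gives the value \<open>0\<close> wherever \<open>F\<close> is \<open>0\<close> or \<open>1\<close>; the density \<open>f\<close> vanishes almost everywhere there.
\<close>

definition g_density ::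
  "(real \<Rightarrow> real) \<Rightarrow> (real \<Rightarrow> real) \<Rightarrow> real \<Rightarrow> real \<Rightarrow> real \<Rightarrow> real" where
  "g_density F f \<beta> \<theta> x =
     \<beta> * \<theta> * f x * (F x powr (\<theta> - 1) * (1 - F x) powr (\<theta> - 1))
       / (\<beta> * F x powr \<theta> + (1 - F x) powr \<theta>)\<^sup>2"

text \<open>
  The odds equation determines \<open>G \<beta> \<theta>\<close> uniquely, with the expected closed form, and the closed
  form is a solution.
\<close>

lemma distribution_function_bounds:
  assumes "distribution_function H"
  shows "0 \<le> H x" "H x \<le> 1"
proof -
  from assms obtain M where M: "real_distribution M" "H = cdf M"
    by (auto simp: distribution_function_def)
  then interpret real_distribution M by simp
  show "0 \<le> H x" "H x \<le> 1" unfolding M(2) by (rule cdf_nonneg, rule cdf_bounded_prob)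
qed

lemma odds_family_of_closed_form:
  assumes F: "distribution_function F" and G: "odds_family_of F G" and pos: "0 < \<beta>" "0 < \<theta>"
  shows "G \<beta> \<theta> x = \<beta> * F x powr \<theta> / (\<beta> * F x powr \<theta> + (1 - F x) powr \<theta>)"
proof -
  note b = distribution_function_bounds[OF F, of x]
  have dG: "distribution_function (G \<beta> \<theta>)"
    and oG: "odds (G \<beta> \<theta>) x = ennreal \<beta> * ennreal_powr (odds F x) \<theta>"
    using G pos by (auto simp: odds_family_of_def)
  note c = distribution_function_bounds[OF dG, of x]
  show ?thesis
  proof (cases "F x = 1")
    case True
    with oG pos have "odds (G \<beta> \<theta>) x = \<top>"
      by (simp add: odds_def ennreal_powr_def ennreal_mult_eq_top_iff)
    then have "G \<beta> \<theta> x = 1" by (simp add: odds_def split: if_splits)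
    with True pos show ?thesis by simp
  next
    case False
    with b have lt: "F x < 1" by simp
    let ?r = "F x / (1 - F x)"
    have r: "0 \<le> ?r" using b lt by simp
    have eq: "odds (G \<beta> \<theta>) x = ennreal (\<beta> * ?r powr \<theta>)"
      using oG lt pos r by (simp add: odds_def ennreal_powr_def ennreal_mult)
    then have ne: "G \<beta> \<theta> x \<noteq> 1" by (auto simp: odds_def)
    with eq have "ennreal (G \<beta> \<theta> x / (1 - G \<beta> \<theta> x)) = ennreal (\<beta> * ?r powr \<theta>)"
      by (simp add: odds_def)
    then have "G \<beta> \<theta> x / (1 - G \<beta> \<theta> x) = \<beta> * ?r powr \<theta>"
      using c ne pos by (subst (asm) ennreal_inj) auto
    then have 1: "G \<beta> \<theta> x / (1 - G \<beta> \<theta> x) = \<beta> * (F x powr \<theta> / (1 - F x) powr \<theta>)"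
      using b lt by (simp add: powr_divide)
    have "0 < (1 - F x) powr \<theta>" using lt by simp
    moreover have "0 < \<beta> * F x powr \<theta> + (1 - F x) powr \<theta>"
      using lt pos by (intro add_nonneg_pos) auto
    ultimately show ?thesis
      using 1 ne by (simp add: field_simps)
  qed
qed

lemma odds_family_of_exists:
  assumes F: "distribution_function F"
  shows "odds_family_of F (\<lambda>\<beta> \<theta> x. \<beta> * F x powr \<theta> / (\<beta> * F x powr \<theta> + (1 - F x) powr \<theta>))"
  unfolding odds_family_of_def
proof (intro allI impI conjI)
  fix \<beta> \<theta> :: real assume pos: "0 < \<beta>" "0 < \<theta>"
  from F obtain M where M: "real_distribution M" "F = cdf M"
    by (auto simp: distribution_function_def)
  then interpret real_distribution M by simp
  have b: "0 \<le> F x" "F x \<le> 1" for x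
    by (rule distribution_function_bounds[OF F])+
  define d where "d u = \<beta> * u powr \<theta> + (1 - u) powr \<theta>" for u
  define p where "p u = \<beta> * u powr \<theta> / d u" for u
  let ?G = "\<lambda>x. p (F x)"
  have d: "0 < d u" if "0 \<le> u" "u \<le> 1" for u
  proof (cases "u = 0")
    case False
    then show ?thesis using that pos unfolding d_def by (intro add_pos_nonneg) auto
  qed (simp add: d_def)
  have lim: "(?G \<longlongrightarrow> p c) A" if "(F \<longlongrightarrow> c) A" "0 \<le> c" "c \<le> 1" for A c
    unfolding p_def d_def using that d[of c] pos b
    by (intro tendsto_intros tendsto_powr')
      (auto simp: d_def intro!: always_eventually)
  have mono: "?G x \<le> ?G y" if "x \<le> y" for x y
  proof -
    have "F x \<le> F y" using that unfolding M(2) by (rule cdf_nondecreasing)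
    then have "F x powr \<theta> * (1 - F y) powr \<theta> \<le> F y powr \<theta> * (1 - F x) powr \<theta>"
      using b[of x] b[of y] pos by (intro mult_mono powr_mono2) auto
    then have "\<beta> * F x powr \<theta> * d (F y) \<le> \<beta> * F y powr \<theta> * d (F x)"
      using pos by (simp add: d_def algebra_simps)
    then show ?thesis
      using d[OF b, of x] d[OF b, of y]
      unfolding p_def by (simp add: divide_le_eq pos_le_divide_eq mult.commute)
  qed
  have rc: "continuous (at_right a) ?G" for a
    unfolding continuous_within
    by (rule lim) (use cdf_is_right_cont[of a] b[of a] in \<open>auto simp: continuous_within M(2)\<close>)
  have l0: "(?G \<longlongrightarrow> 0) at_bot"
  proof -
    have "(F \<longlongrightarrow> 0) at_bot" unfolding M(2) by (rule cdf_lim_at_bot)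
    from lim[OF this] show ?thesis by (simp add: p_def)
  qed
  have l1: "(?G \<longlongrightarrow> 1) at_top"
  proof -
    have "(F \<longlongrightarrow> 1) at_top" unfolding M(2) by (rule cdf_lim_at_top_prob)
    from lim[OF this] show ?thesis using pos by (simp add: p_def d_def)
  qed
  have "real_distribution (interval_measure ?G)"
    by (rule real_distribution_interval_measure[OF mono rc l0 l1])
  moreover have "cdf (interval_measure ?G) = ?G"
    by (rule cdf_interval_measure[OF mono rc l0])
  ultimately have "distribution_function ?G"
    unfolding distribution_function_def by (intro exI[of _ "interval_measure ?G"]) simp
  then show "distribution_function
      (\<lambda>x. \<beta> * F x powr \<theta> / (\<beta> * F x powr \<theta> + (1 - F x) powr \<theta>))"
    by (simp only: p_def d_def)
  show "odds (\<lambda>x. \<beta> * F x powr \<theta> / (\<beta> * F x powr \<theta> + (1 - F x) powr \<theta>)) x =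
      ennreal \<beta> * ennreal_powr (odds F x) \<theta>" for x
  proof (cases "F x = 1")
    case True
    with pos show ?thesis
      by (simp add: odds_def ennreal_powr_def ennreal_mult_eq_top_iff)
  next
    case False
    with b[of x] have lt: "F x < 1" by simp
    have D: "0 < d (F x)" by (rule d) (use b in auto)
    have c: "1 - p (F x) = (1 - F x) powr \<theta> / d (F x)"
      using D by (simp add: p_def field_simps) (simp add: d_def algebra_simps)
    then have ne: "1 - p (F x) \<noteq> 0" using lt D by simp
    have "p (F x) / (1 - p (F x)) = \<beta> * (F x / (1 - F x)) powr \<theta>"
      using D lt b[of x] by (simp add: c) (simp add: p_def powr_divide)
    then have "odds (\<lambda>x. p (F x)) x = ennreal \<beta> * ennreal_powr (odds F x) \<theta>"
      using ne lt pos b[of x] by (simp add: odds_def ennreal_powr_def ennreal_mult)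
    then show ?thesis by (simp only: p_def d_def)
  qed
qed

end

theory Submission
  imports Defs
begin

text \<open>
  The rates are elementary: on the support,
  \<open>h\<^bsub>G\<^esub> = h\<^bsub>F\<^esub> \<beta> / (\<beta> F + 1 - F)\<close> for \<open>\<theta> = 1\<close>, and
  \<open>\<lambda>\<^bsub>G\<^esub> = \<beta> \<theta> \<Lambda>\<^bsub>F\<^esub> powr (\<theta> - 1) \<lambda>\<^bsub>F\<^esub>\<close> in general. What needs care is that \<open>g_density\<close> is a density
  of \<open>G = p \<circ> F\<close>, where \<open>p u = \<beta> u powr \<theta> / (\<beta> u powr \<theta> + (1 - u) powr \<theta>)\<close>, since \<open>f\<close> is merely integrable and \<open>F\<close> need not be differentiable everywhere.
  The probability integral transform replaces the chain rule here: \<open>F\<close> is uniformly distributed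
  under its own law, so the integral of \<open>p' (F t) f t\<close> over \<open>t \<le> x\<close> is the integral of \<open>p'\<close>
  from \<open>0\<close> to \<open>F x\<close>.
\<close>

section \<open>The probability integral transform\<close>

lemma cdf_uniform_measure_unit:
  assumes "0 \<le> u" "u \<le> 1"
  shows "cdf (uniform_measure lborel {0..1::real}) u = u"
proof -
  have "{0..1} \<inter> {..u} = {0..u}" using assms by auto
  then show ?thesis using assms
    by (simp add: cdf_def measure_uniform_measure)
qed

lemma real_distribution_uniform_unit:
  "real_distribution (uniform_measure lborel {0..1::real})"
  by (simp add: real_distribution_def real_distribution_axioms_def prob_space_uniform_measure)

context real_distribution
begin

lemma cdf_borel_measurable [measurable]: "cdf M \<in> borel_measurable borel"
  by (intro borel_measurable_mono monoI cdf_nondecreasing)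

text \<open>The limits 0 and 1 at the two ends supply points with values on either side of
  \<open>u\<close>, and the intermediate value theorem applies between them. The levels 0 and 1 are
  excluded because a continuous cdf need not attain them.\<close>

lemma exists_cdf_eq:
  assumes cont: "\<And>x. isCont (cdf M) x" and u: "0 < u" "u < 1"
  obtains t where "cdf M t = u"
proof -
  have "\<forall>\<^sub>F x in at_bot. cdf M x < u"
    using cdf_lim_at_bot u by (simp add: order_tendsto_iff)
  then obtain a where a: "cdf M a < u" by (auto simp: eventually_at_bot_linorder)
  have "\<forall>\<^sub>F x in at_top. u < cdf M x"
    using cdf_lim_at_top_prob u by (simp add: order_tendsto_iff)
  then obtain b where b: "u < cdf M b" by (auto simp: eventually_at_top_linorder)
  have "a \<le> b"
    using a b cdf_nondecreasing[of b a] by linarith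
  with a b cont have "\<exists>t\<ge>a. t \<le> b \<and> cdf M t = u"
    by (intro IVT) auto
  then show ?thesis using that by auto
qed

text \<open>A point \<open>t\<close> with \<open>cdf M t = u\<close> gives the lower bound, since
  \<open>{..t}\<close> lies in the sublevel set. That set extends beyond \<open>t\<close> where the
  cdf is flat, so the upper bound instead compares it with half-lines at levels \<open>v > u\<close>
  and lets \<open>v\<close> decrease to \<open>u\<close>.\<close>

lemma prob_cdf_le:
  assumes cont: "\<And>x. isCont (cdf M) x" and u: "0 \<le> u" "u \<le> 1"
  shows "prob {t. cdf M t \<le> u} = u"
proof (cases "u = 1")
  case True
  \<comment> \<open>Treated apart, since no level \<open>v\<close> fits strictly between
    \<open>u\<close> and 1.\<close>
  then show ?thesis using prob_space by (simp add: cdf_bounded_prob)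
next
  case False
  have ms: "{t. cdf M t \<le> v} \<in> sets M" for v by measurable
  have lower: "u \<le> prob {t. cdf M t \<le> u}"
  proof (cases "u = 0")
    case False
    with \<open>u \<noteq> 1\<close> u obtain t where t: "cdf M t = u"
      using exists_cdf_eq[OF cont, of u] by (metis order_less_le)
    have "prob {..t} \<le> prob {s. cdf M s \<le> u}"
      using t ms by (intro finite_measure_mono) (auto intro: cdf_nondecreasing)
    with t show ?thesis by (simp add: cdf_def)
  qed simp
  have "prob {t. cdf M t \<le> u} \<le> v" if v: "u < v" "v < 1" for v
  proof -
    from v u obtain t where t: "cdf M t = v"
      using exists_cdf_eq[OF cont, of v] by (metis order_le_less_trans)
    have "s \<le> t" if "cdf M s \<le> u" for s
      using that t v cdf_nondecreasing[of t s] by linarith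
    then have "prob {s. cdf M s \<le> u} \<le> prob {..t}"
      by (intro finite_measure_mono) auto
    with t show ?thesis by (simp add: cdf_def)
  qed
  then have "prob {t. cdf M t \<le> u} \<le> u"
    using dense_ge_bounded[of u 1] False u by auto
  with lower show ?thesis by simp
qed

lemma distr_cdf_eq_uniform:
  assumes cont: "\<And>x. isCont (cdf M) x"
  shows "distr M borel (cdf M) = uniform_measure lborel {0..1}"
proof (rule cdf_unique)
  show D: "real_distribution (distr M borel (cdf M))"
    by (rule real_distribution_distr) measurable
  show "real_distribution (uniform_measure lborel {0..1::real})"
    by (rule real_distribution_uniform_unit)
  interpret D: real_distribution "distr M borel (cdf M)" by (rule D)
  interpret U: real_distribution "uniform_measure lborel {0..1::real}"
    by (rule real_distribution_uniform_unit)
  have mid: "cdf (distr M borel (cdf M)) u = cdf (uniform_measure lborel {0..1}) u"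
    if "0 \<le> u" "u \<le> 1" for u
  proof -
    have "cdf (distr M borel (cdf M)) u = prob {t. cdf M t \<le> u}"
      unfolding cdf_def[of "distr M borel (cdf M)"]
      by (subst measure_distr) (auto simp: vimage_def)
    with prob_cdf_le[OF cont that] cdf_uniform_measure_unit[OF that] show ?thesis by simp
  qed
  show "cdf (distr M borel (cdf M)) = cdf (uniform_measure lborel {0..1})"
  proof
    fix u :: real
    consider "u < 0" | "0 \<le> u" "u \<le> 1" | "1 < u" by linarith
    then show "cdf (distr M borel (cdf M)) u = cdf (uniform_measure lborel {0..1}) u"
    proof cases
      case 1
      \<comment> \<open>Monotonicity and nonnegativity force both cdfs to be 0 left of 0; dually,
        both are 1 right of 1.\<close>
      then show ?thesis
        using mid[of 0] cdf_uniform_measure_unit[of 0] D.cdf_nondecreasing[of u 0]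
          U.cdf_nondecreasing[of u 0] D.cdf_nonneg[of u] U.cdf_nonneg[of u] by simp
    next
      case 3
      then show ?thesis
        using mid[of 1] cdf_uniform_measure_unit[of 1] D.cdf_nondecreasing[of 1 u]
          U.cdf_nondecreasing[of 1 u] D.cdf_bounded_prob[of u] U.cdf_bounded_prob[of u] by simp
    qed (rule mid)
  qed
qed

text \<open>The half-line \<open>{..x}\<close> may be replaced by
  \<open>{t. cdf M t \<le> cdf M x}\<close>. The integrand then depends on \<open>t\<close> only
  through \<open>cdf M t\<close>, and pushing forward along the cdf turns \<open>M\<close> into
  Lebesgue measure on the unit interval.\<close>

lemma nn_integral_cdf_atMost:
  assumes cont: "\<And>x. isCont (cdf M) x" and [measurable]: "q \<in> borel_measurable borel"
  shows "(\<integral>\<^sup>+t. q (cdf M t) * indicator {..x} t \<partial>M) = (\<integral>\<^sup>+u. q u * indicator {0..cdf M x} u \<partial>lborel)"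
proof -
  let ?F = "cdf M"
  have b: "0 \<le> ?F x" "?F x \<le> 1" by (rule cdf_nonneg, rule cdf_bounded_prob)
  have ms: "{t. ?F t \<le> ?F x} \<in> sets M" by measurable
  \<comment> \<open>The difference is the flat stretch of the cdf to the right of \<open>x\<close>;
    it is null because both sets have probability \<open>?F x\<close>.\<close>
  have "prob ({t. ?F t \<le> ?F x} - {..x}) = prob {t. ?F t \<le> ?F x} - prob {..x}"
    using ms by (intro finite_measure_Diff) (auto intro: cdf_nondecreasing)
  also have "\<dots> = 0" using prob_cdf_le[OF cont b] by (simp add: cdf_def)
  finally have "{t. ?F t \<le> ?F x} - {..x} \<in> null_sets M"
    using ms by (auto simp: null_sets_def emeasure_eq_measure)
  then have "AE t in M. t \<notin> {t. ?F t \<le> ?F x} - {..x}" by (rule AE_not_in)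
  then have "AE t in M. q (?F t) * indicator {..x} t = q (?F t) * indicator {..?F x} (?F t)"
    by eventually_elim (auto simp: indicator_def intro: cdf_nondecreasing)
  then have "(\<integral>\<^sup>+t. q (?F t) * indicator {..x} t \<partial>M) =
      (\<integral>\<^sup>+t. q (?F t) * indicator {..?F x} (?F t) \<partial>M)"
    by (rule nn_integral_cong_AE)
  also have "\<dots> = (\<integral>\<^sup>+u. q u * indicator {..?F x} u \<partial>distr M borel ?F)"
    by (subst nn_integral_distr) auto
  also have "\<dots> = (\<integral>\<^sup>+u. q u * indicator {..?F x} u * indicator {0..1} u \<partial>lborel)"
    unfolding distr_cdf_eq_uniform[OF cont]
    by (subst nn_integral_uniform_measure) (auto simp: divide_ennreal_def)
  also have "\<dots> = (\<integral>\<^sup>+u. q u * indicator {0..?F x} u \<partial>lborel)"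
    using b by (intro nn_integral_cong) (auto simp: indicator_def)
  finally show ?thesis .
qed

lemma nn_integral_cdf:
  assumes cont: "\<And>x. isCont (cdf M) x" and [measurable]: "q \<in> borel_measurable borel"
  shows "(\<integral>\<^sup>+t. q (cdf M t) \<partial>M) = (\<integral>\<^sup>+u. q u * indicator {0..1} u \<partial>lborel)"
proof -
  have "(\<integral>\<^sup>+t. q (cdf M t) \<partial>M) = (\<integral>\<^sup>+u. q u \<partial>distr M borel (cdf M))"
    by (subst nn_integral_distr) auto
  then show ?thesis
    unfolding distr_cdf_eq_uniform[OF cont]
    by (simp add: nn_integral_uniform_measure divide_ennreal_def)
qed

end

section \<open>Densities of transformed distribution functions\<close>

lemma has_density_imp_distribution_function:
  "has_density F f \<Longrightarrow> distribution_function F"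
  by (auto simp: has_density_def distribution_function_def)

text \<open>
  No derivative is required at the endpoints: for the odds transform below it is infinite there
  when \<open>\<theta> < 1\<close>, and when \<open>\<theta> = 1\<close> the formula with \<open>powr\<close> has the junk value \<open>0\<close>.
\<close>

lemma nn_integral_FTC_open:
  fixes p q :: "real \<Rightarrow> real"
  assumes c: "0 \<le> c"
    and p: "continuous_on {0..c} p"
    and deriv: "\<And>u. 0 < u \<Longrightarrow> u < c \<Longrightarrow> (p has_real_derivative q u) (at u)"
    and q: "\<And>u. 0 < u \<Longrightarrow> u < c \<Longrightarrow> isCont q u" "\<And>u. 0 \<le> q u"
    and [measurable]: "q \<in> borel_measurable borel"
  shows "(\<integral>\<^sup>+u. ennreal (q u) * indicator {0..c} u \<partial>lborel) = ennreal (p c - p 0)"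
proof (cases "c = 0")
  case True
  have "(\<integral>\<^sup>+u. ennreal (q u) * indicator {0..c} u \<partial>lborel) =
      (\<integral>\<^sup>+u. ennreal (q c) * indicator {c} u \<partial>lborel)"
    using True by (intro nn_integral_cong) (auto simp: indicator_def)
  then show ?thesis using True by (simp add: nn_integral_cmult)
next
  case False
  with c have c: "0 < c" by simp
  have r: "((p \<circ> real_of_ereal) \<longlongrightarrow> p 0) (at_right (ereal 0))"
    using p c by (auto simp: ereal_tendsto_simps continuous_on_Icc_at_rightD)
  have l: "((p \<circ> real_of_ereal) \<longlongrightarrow> p c) (at_left (ereal c))"
    using p c by (auto simp: ereal_tendsto_simps continuous_on_Icc_at_leftD)
  have int: "set_integrable lborel (einterval (ereal 0) (ereal c)) q"
    "(LBINT u=ereal 0..ereal c. q u) = p c - p 0"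
    using c deriv q by (intro interval_integral_FTC_nonneg[OF _ _ _ _ r l]; auto)+
  \<comment> \<open>The two endpoints form a null set, so the values of \<open>q\<close> there drop
    out.\<close>
  have "(\<integral>\<^sup>+u. ennreal (q u) * indicator {0..c} u \<partial>lborel) =
      (\<integral>\<^sup>+u. ennreal (indicator {0<..<c} u * q u) \<partial>lborel)"
    by (rule nn_integral_cong_AE)
      (use AE_lborel_singleton[of 0] AE_lborel_singleton[of c] in
        \<open>eventually_elim, auto simp: indicator_def\<close>)
  also have "\<dots> = ennreal (\<integral>u. indicator {0<..<c} u * q u \<partial>lborel)"
    using int(1) q(2) by (intro nn_integral_eq_integral) (auto simp: set_integrable_def)
  also have "(\<integral>u. indicator {0<..<c} u * q u \<partial>lborel) = p c - p 0"
    using int(2) c by (simp add: interval_lebesgue_integral_def set_lebesgue_integral_def)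
  finally show ?thesis .
qed

text \<open>The candidate measure has density \<open>q (F x)\<close> with respect to the law of
  \<open>F\<close>. By the integral transform its mass on \<open>{..x}\<close> is the integral of
  \<open>q\<close> from 0 to \<open>F x\<close>, that is \<open>p (F x) - p 0\<close>, and its total
  mass is \<open>p 1 - p 0 = 1\<close>.\<close>

lemma has_density_compose:
  fixes p q :: "real \<Rightarrow> real"
  assumes F: "has_density F f"
    and p: "continuous_on {0..1} p" "p 0 = 0" "p 1 = 1"
    and deriv: "\<And>u. 0 < u \<Longrightarrow> u < 1 \<Longrightarrow> (p has_real_derivative q u) (at u)"
    and q: "\<And>u. 0 < u \<Longrightarrow> u < 1 \<Longrightarrow> isCont q u" "\<And>u. 0 \<le> q u"
    and [measurable]: "q \<in> borel_measurable borel"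
  shows "has_density (\<lambda>x. p (F x)) (\<lambda>x. f x * q (F x))"
proof -
  define M where "M = density lborel (\<lambda>x. ennreal (f x))"
  have [measurable]: "f \<in> borel_measurable borel" and f: "\<And>x. 0 \<le> f x"
    and M: "real_distribution M" and FM: "F = cdf M"
    using F by (auto simp: has_density_def M_def)
  interpret real_distribution M by (rule M)
  \<comment> \<open>A law with a Lebesgue density has no atoms, hence a continuous cdf.\<close>
  have cont: "isCont (cdf M) x" for x
  proof -
    have "emeasure M {x} = 0"
      unfolding M_def by (subst emeasure_density)
        (auto simp: nn_integral_0_iff_AE indicator_def intro!: AE_I'[of "{x}"])
    then show ?thesis by (simp add: isCont_cdf measure_def)
  qed
  have ftc: "(\<integral>\<^sup>+u. ennreal (q u) * indicator {0..c} u \<partial>lborel) = ennreal (p c)"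
    if "0 \<le> c" "c \<le> 1" for c
  proof -
    have "continuous_on {0..c} p"
      using p(1) that by (auto intro: continuous_on_subset)
    then show ?thesis
      using nn_integral_FTC_open[of c p q] that p deriv q by auto
  qed
  have [measurable]: "F \<in> borel_measurable borel" unfolding FM by measurable
  define N where "N = density lborel (\<lambda>x. ennreal (f x * q (F x)))"
  have N: "N = density M (\<lambda>x. ennreal (q (F x)))"
    unfolding N_def M_def using f q(2)
    by (subst density_density_eq) (auto simp: ennreal_mult)
  have atMost: "emeasure N {..x} = ennreal (p (F x))" for x
  proof -
    have "emeasure N {..x} = (\<integral>\<^sup>+t. ennreal (q (cdf M t)) * indicator {..x} t \<partial>M)"
      unfolding N by (subst emeasure_density) (auto simp: FM)
    also have "\<dots> = ennreal (p (F x))"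
      using nn_integral_cdf_atMost[OF cont, of "\<lambda>u. ennreal (q u)" x]
        ftc[of "F x"] cdf_nonneg[of x] cdf_bounded_prob[of x] by (simp add: FM)
    finally show ?thesis .
  qed
  have "emeasure N UNIV = (\<integral>\<^sup>+t. ennreal (q (cdf M t)) \<partial>M)"
    unfolding N by (subst emeasure_density) (auto simp: FM)
  also have "\<dots> = 1"
    using nn_integral_cdf[OF cont, of "\<lambda>u. ennreal (q u)"] ftc[of 1] p by simp
  finally have "prob_space N" by (intro prob_spaceI) (simp add: N_def)
  then have rN: "real_distribution N"
    by (simp add: real_distribution_def real_distribution_axioms_def N_def)
  \<comment> \<open>\<open>ennreal\<close> sends negative reals to 0, so the value of the cdf can be
    read off from \<open>atMost\<close> only once \<open>p (F x)\<close> is known to be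
    nonnegative.\<close>
  have nonneg: "0 \<le> p (F x)" for x
  proof (cases "F x = 0")
    case False
    have b: "0 \<le> F x" "F x \<le> 1" by (simp_all add: FM cdf_nonneg cdf_bounded_prob)
    have "p 0 \<le> p (F x)"
    proof (rule DERIV_nonneg_imp_increasing_open[OF b(1)])
      show "continuous_on {0..F x} p" using p(1) b by (auto intro: continuous_on_subset)
    qed (use b deriv q(2) in \<open>meson less_le_trans\<close>)
    with p show ?thesis by simp
  qed (simp add: p)
  have "(\<lambda>x. p (F x)) = cdf N"
    using atMost nonneg by (simp add: fun_eq_iff cdf_def measure_def)
  with rN f q(2) show ?thesis by (auto simp: has_density_def N_def)
qed

section \<open>The odds transform\<close>

text \<open>Away from 0 the first summand is positive; at 0 the second equals 1 for every
  \<theta>.\<close>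

lemma odds_transform_denom_pos:
  fixes \<beta> \<theta> u :: real
  assumes "0 < \<beta>" "0 \<le> u" "u \<le> 1"
  shows "0 < \<beta> * u powr \<theta> + (1 - u) powr \<theta>"
proof (cases "u = 0")
  case False
  then show ?thesis using assms by (intro add_pos_nonneg) auto
qed simp

lemma odds_transform_has_derivative:
  fixes \<beta> \<theta> u :: real
  assumes "0 < \<beta>" "0 < u" "u < 1"
  shows "((\<lambda>u. \<beta> * u powr \<theta> / (\<beta> * u powr \<theta> + (1 - u) powr \<theta>)) has_real_derivative
    \<beta> * \<theta> * (u powr (\<theta> - 1) * (1 - u) powr (\<theta> - 1)) /
      (\<beta> * u powr \<theta> + (1 - u) powr \<theta>)\<^sup>2) (at u)"
proof -
  let ?D = "\<beta> * u powr \<theta> + (1 - u) powr \<theta>"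
  have D: "0 < ?D" using odds_transform_denom_pos[of \<beta> u \<theta>] assms by simp
  \<comment> \<open>After this splitting the terms in \<beta> squared cancel in the quotient rule,
    and the remaining two add up through \<open>u + (1 - u) = 1\<close>.\<close>
  have e: "u powr \<theta> = u * u powr (\<theta> - 1)" "(1 - u) powr \<theta> = (1 - u) * (1 - u) powr (\<theta> - 1)"
    using assms by (simp_all add: powr_diff)
  have d1: "((\<lambda>u. u powr \<theta>) has_real_derivative \<theta> * u powr (\<theta> - 1)) (at u)"
    using assms by (intro has_real_derivative_powr) auto
  have "((\<lambda>u. (1 - u) powr \<theta>) has_real_derivative \<theta> * (1 - u) powr (\<theta> - of_nat 1) * (0 - 1)) (at u)"
    using assms by (intro DERIV_powr derivative_eq_intros) auto
  then have d2: "((\<lambda>u. (1 - u) powr \<theta>) has_real_derivative - (\<theta> * (1 - u) powr (\<theta> - 1))) (at u)"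
    by simp
  have "((\<lambda>u. \<beta> * u powr \<theta> / (\<beta> * u powr \<theta> + (1 - u) powr \<theta>)) has_real_derivative
     (\<beta> * (\<theta> * u powr (\<theta> - 1)) * ?D -
       \<beta> * u powr \<theta> * (\<beta> * (\<theta> * u powr (\<theta> - 1)) + - (\<theta> * (1 - u) powr (\<theta> - 1)))) /
     (?D * ?D)) (at u)"
    using D by (intro DERIV_divide DERIV_add DERIV_cmult d1 d2) auto
  moreover have "\<beta> * (\<theta> * u powr (\<theta> - 1)) * ?D -
       \<beta> * u powr \<theta> * (\<beta> * (\<theta> * u powr (\<theta> - 1)) + - (\<theta> * (1 - u) powr (\<theta> - 1))) =
      \<beta> * \<theta> * (u powr (\<theta> - 1) * (1 - u) powr (\<theta> - 1))"
    unfolding e by algebra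
  ultimately show ?thesis by (simp add: power2_eq_square)
qed

lemma has_density_odds_family:
  assumes F: "has_density F f" and G: "odds_family_of F G" and pos: "0 < \<beta>" "0 < \<theta>"
  shows "has_density (G \<beta> \<theta>) (g_density F f \<beta> \<theta>)"
proof -
  let ?p = "\<lambda>u. \<beta> * u powr \<theta> / (\<beta> * u powr \<theta> + (1 - u) powr \<theta>)"
  let ?q = "\<lambda>u. \<beta> * \<theta> * (u powr (\<theta> - 1) * (1 - u) powr (\<theta> - 1)) /
      (\<beta> * u powr \<theta> + (1 - u) powr \<theta>)\<^sup>2"
  have D: "\<beta> * u powr \<theta> + (1 - u) powr \<theta> \<noteq> 0" if "0 \<le> u" "u \<le> 1" for u
    using odds_transform_denom_pos[of \<beta> u \<theta>] that pos by simp
  have "has_density (\<lambda>x. ?p (F x)) (\<lambda>x. f x * ?q (F x))"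
  proof (rule has_density_compose[OF F])
    \<comment> \<open>Continuity at the endpoints rests on \<theta> being positive; the derivative
      is examined only in the open interval.\<close>
    show "continuous_on {0..1} ?p"
      using D pos by (intro continuous_intros continuous_on_powr') auto
    show "isCont ?q u" if "0 < u" "u < 1" for u
      using D[of u] that by (intro continuous_intros) auto
  qed (use pos in \<open>auto intro!: odds_transform_has_derivative\<close>)
  moreover have "G \<beta> \<theta> = (\<lambda>x. ?p (F x))"
    using odds_family_of_closed_form[OF has_density_imp_distribution_function[OF F] G pos]
    by (simp add: fun_eq_iff)
  moreover have "g_density F f \<beta> \<theta> = (\<lambda>x. f x * ?q (F x))"
    by (simp add: fun_eq_iff g_density_def)
  ultimately show ?thesis by simp
qed

section \<open>Monotonicity of the rates\<close>

context
  fixes F f :: "real \<Rightarrow> real" and G :: "real \<Rightarrow> real \<Rightarrow> real \<Rightarrow> real" and \<beta> \<theta> :: real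
  assumes F: "has_density F f" and G: "odds_family_of F G" and pos: "0 < \<beta>" "0 < \<theta>"
begin

lemma odds_family_survival:
  "1 - G \<beta> \<theta> x = (1 - F x) powr \<theta> / (\<beta> * F x powr \<theta> + (1 - F x) powr \<theta>)"
proof -
  note dF = has_density_imp_distribution_function[OF F]
  have "0 < \<beta> * F x powr \<theta> + (1 - F x) powr \<theta>"
    using odds_transform_denom_pos pos distribution_function_bounds[OF dF] by blast
  then show ?thesis
    unfolding odds_family_of_closed_form[OF dF G pos] by (simp add: field_simps)
qed

text \<open>Monotonicity of a rate of \<open>G\<close> is demanded on the support of
  \<open>G\<close>; this allows it to be proved on the support of \<open>F\<close>.\<close>

lemma odds_family_support: "{x. 0 < G \<beta> \<theta> x \<and> G \<beta> \<theta> x < 1} = {x. 0 < F x \<and> F x < 1}"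
proof -
  note dF = has_density_imp_distribution_function[OF F]
  have "0 < G \<beta> \<theta> x \<and> G \<beta> \<theta> x < 1 \<longleftrightarrow> 0 < F x \<and> F x < 1" for x
  proof -
    note b = distribution_function_bounds[OF dF, of x]
    have D: "0 < \<beta> * F x powr \<theta> + (1 - F x) powr \<theta>"
      using odds_transform_denom_pos pos b by blast
    have "0 < G \<beta> \<theta> x \<longleftrightarrow> 0 < F x"
      using D b pos unfolding odds_family_of_closed_form[OF dF G pos]
      by (auto simp: zero_less_divide_iff zero_less_mult_iff)
    moreover have "0 < 1 - G \<beta> \<theta> x \<longleftrightarrow> 0 < 1 - F x"
      using D b unfolding odds_family_survival
      by (auto simp: zero_less_divide_iff)
    ultimately show ?thesis by simp
  qed
  then show ?thesis by simp
qed

text \<open>This is the chain rule for \<beta> times the \<theta>-th power of the odds, obtained by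
  pure algebra: the squared denominator of \<open>g_density\<close> cancels against that of the
  squared survival function.\<close>

lemma odds_rate_odds_family:
  assumes "0 < F x" "F x < 1"
  shows "odds_rate (G \<beta> \<theta>) (g_density F f \<beta> \<theta>) x =
    \<beta> * \<theta> * (F x / (1 - F x)) powr (\<theta> - 1) * odds_rate F f x"
proof -
  define D where "D = \<beta> * F x powr \<theta> + (1 - F x) powr \<theta>"
  have D: "0 < D" unfolding D_def using odds_transform_denom_pos assms pos by simp
  have e: "(1 - F x) powr \<theta> = (1 - F x) * (1 - F x) powr (\<theta> - 1)"
    using assms by (simp add: powr_diff)
  have "odds_rate (G \<beta> \<theta>) (g_density F f \<beta> \<theta>) x =
      \<beta> * \<theta> * f x * (F x powr (\<theta> - 1) * (1 - F x) powr (\<theta> - 1)) / ((1 - F x) powr \<theta>)\<^sup>2"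
    unfolding odds_rate_def g_density_def odds_family_survival D_def[symmetric]
    using D by (simp add: power_divide)
  also have "\<dots> = \<beta> * \<theta> * (F x powr (\<theta> - 1) / (1 - F x) powr (\<theta> - 1)) * odds_rate F f x"
    using assms unfolding e odds_rate_def by (simp add: power2_eq_square ac_simps)
  finally show ?thesis using assms by (simp add: powr_divide)
qed

end

lemma hazard_rate_odds_family:
  assumes F: "has_density F f" and G: "odds_family_of F G" and \<beta>: "0 < \<beta>"
    and x: "0 < F x" "F x < 1"
  shows "hazard_rate (G \<beta> 1) (g_density F f \<beta> 1) x =
    hazard_rate F f x * (\<beta> / (\<beta> * F x + (1 - F x)))"
proof -
  define D where "D = \<beta> * F x + (1 - F x)"
  have "0 < D" unfolding D_def using x \<beta> by (intro add_pos_pos) auto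
  moreover have "1 - G \<beta> 1 x = (1 - F x) / D"
    using odds_family_survival[OF F G \<beta>, of 1 x] x by (simp add: D_def)
  \<comment> \<open>Both powers have exponent 0 and equal 1 because \<open>F x\<close> and
    \<open>1 - F x\<close> are nonzero on the support; \<open>0 powr 0\<close> would be 0.\<close>
  moreover have "g_density F f \<beta> 1 x = \<beta> * f x / D\<^sup>2"
    using x by (simp add: g_density_def D_def)
  ultimately show ?thesis
    using x unfolding D_def[symmetric] hazard_rate_def by (simp add: power2_eq_square ac_simps)
qed

section \<open>Preservation of monotone rates\<close>

lemma hazard_rate_nonneg:
  "has_density F f \<Longrightarrow> F x < 1 \<Longrightarrow> 0 \<le> hazard_rate F f x"
  by (simp add: has_density_def hazard_rate_def)

lemma odds_rate_nonneg:
  "has_density F f \<Longrightarrow> 0 \<le> odds_rate F f x"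
  by (simp add: has_density_def odds_rate_def)

lemma has_density_mono: "has_density F f \<Longrightarrow> x \<le> y \<Longrightarrow> F x \<le> F y"
  by (auto simp: has_density_def intro!: finite_borel_measure.cdf_nondecreasing
      real_distribution.finite_borel_measure_M)

text \<open>The denominator of the extra factor is \<open>1 - (1 - \<beta>) * F x\<close>, which
  decreases in \<open>x\<close> for \<beta> at most 1. So the rate is a product of two nonnegative
  increasing functions.\<close>

lemma increasing_hazard_rate_odds_family:
  assumes H: "increasing_hazard_rate F f" and G: "odds_family_of F G" and \<beta>: "0 < \<beta>" "\<beta> \<le> 1"
  shows "increasing_hazard_rate (G \<beta> 1) (g_density F f \<beta> 1)"
proof -
  from H have F: "has_density F f"
    and mono: "mono_on {x. 0 < F x \<and> F x < 1} (hazard_rate F f)"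
    by (auto simp: increasing_hazard_rate_def)
  have "mono_on {x. 0 < F x \<and> F x < 1} (hazard_rate (G \<beta> 1) (g_density F f \<beta> 1))"
  proof (rule mono_onI)
    fix x y assume xy: "x \<in> {x. 0 < F x \<and> F x < 1}" "y \<in> {x. 0 < F x \<and> F x < 1}" "x \<le> y"
    have D: "0 < \<beta> * F z + (1 - F z)" if "F z \<in> {0<..<1}" for z
      using that \<beta> by (intro add_pos_pos) auto
    have "(1 - \<beta>) * F x \<le> (1 - \<beta>) * F y"
      using \<beta> has_density_mono[OF F xy(3)] by (intro mult_left_mono) auto
    then have "\<beta> * F y + (1 - F y) \<le> \<beta> * F x + (1 - F x)" by (simp add: algebra_simps)
    then have "\<beta> / (\<beta> * F x + (1 - F x)) \<le> \<beta> / (\<beta> * F y + (1 - F y))"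
      using xy \<beta> by (intro divide_left_mono mult_pos_pos D) auto
    moreover have "hazard_rate F f x \<le> hazard_rate F f y"
      using mono_onD[OF mono] xy by blast
    ultimately have "hazard_rate F f x * (\<beta> / (\<beta> * F x + (1 - F x))) \<le>
        hazard_rate F f y * (\<beta> / (\<beta> * F y + (1 - F y)))"
      using xy \<beta> D[of x] hazard_rate_nonneg[OF F, of y] by (intro mult_mono) auto
    then show "hazard_rate (G \<beta> 1) (g_density F f \<beta> 1) x \<le>
        hazard_rate (G \<beta> 1) (g_density F f \<beta> 1) y"
      using xy by (simp add: hazard_rate_odds_family[OF F G \<beta>(1)])
  qed
  then show ?thesis
    using has_density_odds_family[OF F G \<beta>(1), of 1] odds_family_support[OF F G \<beta>(1), of 1]
    by (simp add: increasing_hazard_rate_def)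
qed

text \<open>Here the denominator is \<open>1 + (\<beta> - 1) * F x\<close>, which increases in
  \<open>x\<close>, so both nonnegative factors decrease.\<close>

lemma decreasing_hazard_rate_odds_family:
  assumes H: "decreasing_hazard_rate F f" and G: "odds_family_of F G" and \<beta>: "1 \<le> \<beta>"
  shows "decreasing_hazard_rate (G \<beta> 1) (g_density F f \<beta> 1)"
proof -
  from H have F: "has_density F f"
    and anti: "antimono_on {x. 0 < F x \<and> F x < 1} (hazard_rate F f)"
    by (auto simp: decreasing_hazard_rate_def)
  have \<beta>0: "0 < \<beta>" using \<beta> by simp
  have "antimono_on {x. 0 < F x \<and> F x < 1} (hazard_rate (G \<beta> 1) (g_density F f \<beta> 1))"
  proof (rule monotone_onI)
    fix x y assume xy: "x \<in> {x. 0 < F x \<and> F x < 1}" "y \<in> {x. 0 < F x \<and> F x < 1}" "x \<le> y"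
    have D: "0 < \<beta> * F z + (1 - F z)" if "F z \<in> {0<..<1}" for z
      using that \<beta>0 by (intro add_pos_pos) auto
    have "(\<beta> - 1) * F x \<le> (\<beta> - 1) * F y"
      using \<beta> has_density_mono[OF F xy(3)] by (intro mult_left_mono) auto
    then have "\<beta> * F x + (1 - F x) \<le> \<beta> * F y + (1 - F y)" by (simp add: algebra_simps)
    then have "\<beta> / (\<beta> * F y + (1 - F y)) \<le> \<beta> / (\<beta> * F x + (1 - F x))"
      using xy \<beta>0 by (intro divide_left_mono mult_pos_pos D) auto
    moreover have "hazard_rate F f y \<le> hazard_rate F f x"
      using monotone_onD[OF anti] xy by blast
    ultimately have "hazard_rate F f y * (\<beta> / (\<beta> * F y + (1 - F y))) \<le>
        hazard_rate F f x * (\<beta> / (\<beta> * F x + (1 - F x)))"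
      using xy \<beta>0 D[of y] hazard_rate_nonneg[OF F, of x] by (intro mult_mono) auto
    then show "hazard_rate (G \<beta> 1) (g_density F f \<beta> 1) y \<le>
        hazard_rate (G \<beta> 1) (g_density F f \<beta> 1) x"
      using xy by (simp add: hazard_rate_odds_family[OF F G \<beta>0])
  qed
  then show ?thesis
    using has_density_odds_family[OF F G \<beta>0, of 1] odds_family_support[OF F G \<beta>0, of 1]
    by (simp add: decreasing_hazard_rate_def)
qed

text \<open>The odds of \<open>F\<close> increase with \<open>F\<close>, and the exponent
  \<open>\<theta> - 1\<close> is nonnegative, so the extra factor increases and multiplies a
  nonnegative increasing rate.\<close>

lemma increasing_odds_rate_odds_family:
  assumes H: "increasing_odds_rate F f" and G: "odds_family_of F G" and \<beta>: "0 < \<beta>" and \<theta>: "1 \<le> \<theta>"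
  shows "increasing_odds_rate (G \<beta> \<theta>) (g_density F f \<beta> \<theta>)"
proof -
  from H have F: "has_density F f"
    and mono: "mono_on {x. 0 < F x \<and> F x < 1} (odds_rate F f)"
    by (auto simp: increasing_odds_rate_def)
  have \<theta>0: "0 < \<theta>" using \<theta> by simp
  have "mono_on {x. 0 < F x \<and> F x < 1} (odds_rate (G \<beta> \<theta>) (g_density F f \<beta> \<theta>))"
  proof (rule mono_onI)
    fix x y assume xy: "x \<in> {x. 0 < F x \<and> F x < 1}" "y \<in> {x. 0 < F x \<and> F x < 1}" "x \<le> y"
    have "F x / (1 - F x) \<le> F y / (1 - F y)"
      using xy has_density_mono[OF F xy(3)] by (intro frac_le) auto
    then have "(F x / (1 - F x)) powr (\<theta> - 1) \<le> (F y / (1 - F y)) powr (\<theta> - 1)"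
      using xy \<theta> by (intro powr_mono2) auto
    moreover have "odds_rate F f x \<le> odds_rate F f y"
      using mono_onD[OF mono] xy by blast
    ultimately have "\<beta> * \<theta> * (F x / (1 - F x)) powr (\<theta> - 1) * odds_rate F f x \<le>
        \<beta> * \<theta> * (F y / (1 - F y)) powr (\<theta> - 1) * odds_rate F f y"
      using \<beta> \<theta>0 odds_rate_nonneg[OF F] by (intro mult_mono mult_left_mono) auto
    then show "odds_rate (G \<beta> \<theta>) (g_density F f \<beta> \<theta>) x \<le>
        odds_rate (G \<beta> \<theta>) (g_density F f \<beta> \<theta>) y"
      using xy by (simp add: odds_rate_odds_family[OF F G \<beta> \<theta>0])
  qed
  then show ?thesis
    using has_density_odds_family[OF F G \<beta> \<theta>0] odds_family_support[OF F G \<beta> \<theta>0]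
    by (simp add: increasing_odds_rate_def)
qed

theorem theorem3p3:
  fixes F f :: "real \<Rightarrow> real"
    and G :: "real \<Rightarrow> real \<Rightarrow> real \<Rightarrow> real"
  assumes "has_density F f"
    and "odds_family_of F G"
  shows "(\<forall>\<beta>. increasing_hazard_rate F f \<and> 0 < \<beta> \<and> \<beta> \<le> 1 \<longrightarrow>
             increasing_hazard_rate (G \<beta> 1) (g_density F f \<beta> 1)) \<and>
         (\<forall>\<beta>. decreasing_hazard_rate F f \<and> 1 \<le> \<beta> \<longrightarrow>
             decreasing_hazard_rate (G \<beta> 1) (g_density F f \<beta> 1)) \<and>
         (\<forall>\<beta> \<theta>. increasing_odds_rate F f \<and> 0 < \<beta> \<and> 1 \<le> \<theta> \<longrightarrow>
             increasing_odds_rate (G \<beta> \<theta>) (g_density F f \<beta> \<theta>))"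
  using assms(2) increasing_hazard_rate_odds_family decreasing_hazard_rate_odds_family
    increasing_odds_rate_odds_family by blast

end
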